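(* Let $\Phi\subseteq\mathbb{R}^n$ and let $f\colon\Phi\to\mathbb{R}$ be such that the problem $\min\{f(x):x\in\Phi\}$ can be solved by (spatial) branch-and-bound. Let $\Gamma$ be a finite group of symmetries of this problem. Suppose that the branch-and-bound method generates a finite full branch-and-bound tree $\mathcal{B}=(\mathcal{V},\mathcal{E})$ with node regions $\Phi(\beta)$, $\beta\in\mathcal{V}$. For each node $\beta\in\mathcal{V}$ let $(m_\beta,\pi_\beta,\varphi_\beta)\in\{0,1,\dots,n\}\times\mathcal{S}_n\times\Gamma$, and let $\sigma_\beta\colon\mathbb{R}^n\to\mathbb{R}^{m_\beta}$ map $x$ to the vector of the first $m_\beta$ entries of $\pi_\beta(\varphi_\beta(x))$. Suppose that, at every node $\beta\in\mathcal{V}$, one enforces the symmetry handling constraints $$\sigma_\beta(x)\succeq\sigma_\beta(\gamma(x))\quad\text{for all }\gamma\in\Gamma. \qquad (\ast)_\beta$$ Assume that the following conditions hold for all nodes $\beta\in\mathcal{V}$: (C1) If $\beta$ has a parent $\alpha\in\mathcal{V}$, then $m_\beta\ge m_\alpha$ and $\pi_\alpha(x)_i=\pi_\beta(x)_i$ for all $i\le m_\alpha$ and all $x\in\mathbb{R}^n$. (C2) If $\beta$ has a parent $\alpha\in\mathcal{V}$, then $\varphi_\beta=\varphi_\alpha\circ\psi_\alpha$ for some $\psi_\alpha\in\{\gamma\in\Gamma:\Phi(\alpha)=\gamma(\Phi(\alpha))\}$. (C3) If $\beta$ has a sibling $\beta'\in\mathcal{V}$, then $m_\beta=m_{\beta'}$,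 $\pi_\beta=\pi_{\beta'}$ and $\varphi_\beta=\varphi_{\beta'}$ (i.e., $\psi_\alpha$ in (C2) does not depend on the child $\beta$). (C4) If $x\in\Phi(\beta)$, then for all $\xi\in\Gamma$ with $\sigma_\beta(x)=\sigma_\beta(\xi(x))$ also $\xi(x)\in\Phi(\beta)$. Then, for each $\tilde x\in\Phi$, there is exactly one leaf $\nu$ of $\mathcal{B}$ containing a solution symmetric to $\tilde x$ that is not cut off by the enforced constraints, i.e., exactly one leaf $\nu$ for which there is $\xi\in\Gamma$ such that $\xi(\tilde x)\in\Phi(\nu)$ and $x=\xi(\tilde x)$ satisfies $(\ast)_\nu$.
   Context: A symmetry of $\min\{f(x):x\in\Phi\}$ is a bijection $\gamma\colon\mathbb{R}^n\to\mathbb{R}^n$ preserving objective values ($f(\gamma(x))=f(x)$) and feasibility ($x\in\Phi$ if and only if $\gamma(x)\in\Phi$). Group elements of $\Gamma$ need not be permutations of coordinates; the group operation is composition. $\mathcal{S}_n$ is the symmetric group on $\{1,\dots,n\}$. A permutation $\pi\in\mathcal{S}_n$ acts on $x\in\mathbb{R}^n$ by $\pi(x)=(x_{\pi^{-1}(i)})_{i=1}^n$. For $x,y\in\mathbb{R}^m$, $x\succ y$ means that there is $k$ with $x_i=y_i$ for $i<k$ and $x_k>y_k$; $x\succeq y$ means $x\succ y$ or $x=y$ (lexicographic order). A full branch-and-bound tree is a rooted tree $\mathcal{B}=(\mathcal{V},\mathcal{E})$ in which each node $\beta$ carries a region $\Phi(\beta)\subseteq\Phi$ (the intersection of $\Phi$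 with the branching decisions on the path to $\beta$), the root has region $\Phi$, and for every non-leaf $\beta$ the regions $\Phi(\omega)$ of its children $\omega$ partition $\Phi(\beta)$. Nodes are not pruned by objective value, and no cutting planes or bound propagation are applied. *)

theory Defs
  imports Complex_Main "HOL-Library.Disjoint_Sets" "HOL-Combinatorics.Permutations" "HOL-Algebra.Bij"
begin

text \<open>
  The dimensions m of the vectors compared below vary from node to node, so R^m is
  the set of real functions on \<open>{1..m}\<close>.  They take the value \<^const>\<open>undefined\<close> outside
  \<open>{1..m}\<close>, so that HOL equality of two members is equality of vectors.
\<close>

type_synonym vector = "nat \<Rightarrow> real"

definition Rn :: "nat \<Rightarrow> vector set" where
  "Rn m = ({1..m} \<rightarrow>\<^sub>E UNIV)"

definition lex_greater :: "nat \<Rightarrow> vector \<Rightarrow> vector \<Rightarrow> bool" where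
  "lex_greater m x y \<longleftrightarrow> (\<exists>k\<in>{1..m}. (\<forall>i\<in>{1..<k}. x i = y i) \<and> x k > y k)"

definition lex_geq :: "nat \<Rightarrow> vector \<Rightarrow> vector \<Rightarrow> bool" where
  "lex_geq m x y \<longleftrightarrow> lex_greater m x y \<or> x = y"

definition perm_action :: "nat \<Rightarrow> (nat \<Rightarrow> nat) \<Rightarrow> vector \<Rightarrow> vector" where
  "perm_action n p x = (\<lambda>i\<in>{1..n}. x (inv_into UNIV p i))"

text \<open>
  The objective function is only meaningful on the feasible region \<open>\<Phi>\<close>; its values
  elsewhere are irrelevant.  Symmetries are bijections of R^n; they need not be linear.
\<close>

definition is_symmetry ::
    "nat \<Rightarrow> vector set \<Rightarrow> (vector \<Rightarrow> real) \<Rightarrow> (vector \<Rightarrow> vector) \<Rightarrow> bool" where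
  "is_symmetry n \<Phi> f \<gamma> \<longleftrightarrow>
     \<gamma> \<in> Bij (Rn n) \<and>
     (\<forall>x\<in>Rn n. x \<in> \<Phi> \<longleftrightarrow> \<gamma> x \<in> \<Phi>) \<and>
     (\<forall>x\<in>\<Phi>. f (\<gamma> x) = f x)"

definition finite_symmetry_group ::
    "nat \<Rightarrow> vector set \<Rightarrow> (vector \<Rightarrow> real) \<Rightarrow> (vector \<Rightarrow> vector) set \<Rightarrow> bool" where
  "finite_symmetry_group n \<Phi> f \<Gamma> \<longleftrightarrow>
     finite \<Gamma> \<and> subgroup \<Gamma> (BijGroup (Rn n)) \<and> (\<forall>\<gamma>\<in>\<Gamma>. is_symmetry n \<Phi> f \<gamma>)"

text \<open>Edges point from parent to child.\<close>

definition finite_rooted_tree :: "'v set \<Rightarrow> ('v \<times> 'v) set \<Rightarrow> 'v \<Rightarrow> bool" where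
  "finite_rooted_tree V E r \<longleftrightarrow>
     finite V \<and> E \<subseteq> V \<times> V \<and> r \<in> V \<and>
     (\<forall>u. (u, r) \<notin> E) \<and>
     (\<forall>v\<in>V - {r}. \<exists>!u. (u, v) \<in> E) \<and>
     (\<forall>v\<in>V. (r, v) \<in> E\<^sup>*)"

definition siblings :: "('v \<times> 'v) set \<Rightarrow> 'v \<Rightarrow> 'v \<Rightarrow> bool" where
  "siblings E v w \<longleftrightarrow> v \<noteq> w \<and> (\<exists>u. (u, v) \<in> E \<and> (u, w) \<in> E)"

definition leaf :: "'v set \<Rightarrow> ('v \<times> 'v) set \<Rightarrow> 'v \<Rightarrow> bool" where
  "leaf V E v \<longleftrightarrow> v \<in> V \<and> (\<forall>w. (v, w) \<notin> E)"

text \<open>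
  \<open>D u v\<close> is the set of points satisfying the branching decision that creates the child
  \<open>v\<close> of \<open>u\<close>.  In a rooted tree, the edges \<open>(u, v)\<close> with \<open>(v, \<beta>) \<in> E\<^sup>*\<close> are those of
  the path from the root to \<open>\<beta>\<close>.
\<close>

definition region ::
    "('v \<times> 'v) set \<Rightarrow> ('v \<Rightarrow> 'v \<Rightarrow> vector set) \<Rightarrow> vector set \<Rightarrow> 'v \<Rightarrow> vector set" where
  "region E D \<Phi> \<beta> = \<Phi> \<inter> (\<Inter>(u, v)\<in>{(u, v) \<in> E. (v, \<beta>) \<in> E\<^sup>*}. D u v)"

text \<open>
  The regions of the children may be empty (infeasible children), but regions of distinct
  children have to be disjoint.  That the root has region \<open>\<Phi>\<close> holds by the definition of
  \<^const>\<open>region\<close>.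
\<close>

definition full_bnb_tree ::
    "'v set \<Rightarrow> ('v \<times> 'v) set \<Rightarrow> 'v \<Rightarrow> ('v \<Rightarrow> 'v \<Rightarrow> vector set) \<Rightarrow> vector set \<Rightarrow> bool" where
  "full_bnb_tree V E r D \<Phi> \<longleftrightarrow>
     finite_rooted_tree V E r \<and>
     (\<forall>\<beta>\<in>V. \<not> leaf V E \<beta> \<longrightarrow>
        region E D \<Phi> \<beta> = (\<Union>\<omega>\<in>{\<omega>. (\<beta>, \<omega>) \<in> E}. region E D \<Phi> \<omega>) \<and>
        disjoint_family_on (region E D \<Phi>) {\<omega>. (\<beta>, \<omega>) \<in> E})"

definition sigma ::
    "nat \<Rightarrow> nat \<Rightarrow> (nat \<Rightarrow> nat) \<Rightarrow> (vector \<Rightarrow> vector) \<Rightarrow> vector \<Rightarrow> vector" where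
  "sigma n m p \<phi> x = (\<lambda>i\<in>{1..m}. perm_action n p (\<phi> x) i)"

definition satisfies_shc ::
    "nat \<Rightarrow> (vector \<Rightarrow> vector) set \<Rightarrow> nat \<Rightarrow> (nat \<Rightarrow> nat) \<Rightarrow> (vector \<Rightarrow> vector) \<Rightarrow> vector \<Rightarrow> bool" where
  "satisfies_shc n \<Gamma> m p \<phi> x \<longleftrightarrow>
     (\<forall>\<gamma>\<in>\<Gamma>. lex_geq m (sigma n m p \<phi> x) (sigma n m p \<phi> (\<gamma> x)))"

end

theory Submission
  imports Defs
begin

text \<open>
  Fix a feasible point \<open>x\<close> with its finite orbit \<open>O\<close>.  A point \<open>z\<close> of \<open>O\<close> survives the
  constraints at a node \<open>\<beta>\<close> iff it maximizes \<open>\<sigma>\<^sub>\<beta>\<close> lexicographically over all of \<open>O\<close>.  Call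
  a node occupied if its region contains such a maximizer.  Condition C4 makes this an
  all-or-nothing property: if one maximizer lies in the region, then all of them do, because they
  share the same value of \<open>\<sigma>\<^sub>\<beta>\<close>.

  The link between a node \<open>\<alpha>\<close> and its child \<open>\<beta>\<close> is that, by C1 and C2, the first \<open>m\<^sub>\<alpha>\<close>
  entries of \<open>\<sigma>\<^sub>\<beta>(z)\<close> form \<open>\<sigma>\<^sub>\<alpha>(\<psi>(z))\<close>, with \<open>\<psi>\<close> as in C2.  Truncation is monotone for the lexicographic order and
  \<open>\<psi>\<close> permutes \<open>O\<close>, so \<open>\<psi>\<close> sends maximizers for \<open>\<beta>\<close> to maximizers for \<open>\<alpha>\<close>
  (\<open>lex_maximizer_truncate\<close>).  Two consequences follow, using that \<open>\<psi>\<close> also preserves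
  the region of \<open>\<alpha>\<close>.  If \<open>\<beta>\<close> is occupied, so is \<open>\<alpha>\<close>.  If \<open>\<alpha>\<close> is occupied and \<open>z\<close> is any
  maximizer for its children, which share \<open>\<sigma>\<close> by C3, then \<open>\<psi>(z)\<close>, and hence \<open>z\<close>, lies in the
  region of \<open>\<alpha>\<close>, therefore in the region of a child; C4 and the disjointness of the regions
  leave only one child.

  The root is occupied because \<open>O\<close> is finite and contained in \<open>\<Phi>\<close>.  The occupied nodes thus form
  a single path from the root to a leaf (\<open>ex1_marked_leaf\<close>).
\<close>

section \<open>The lexicographic order\<close>

lemma lex_greater_trans:
  assumes "lex_greater m x y" "lex_greater m y z"
  shows "lex_greater m x z"
proof -
  obtain k where k: "k \<in> {1..m}" "\<forall>i\<in>{1..<k}. x i = y i" "x k > y k"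
    using assms(1) unfolding lex_greater_def by blast
  obtain l where l: "l \<in> {1..m}" "\<forall>i\<in>{1..<l}. y i = z i" "y l > z l"
    using assms(2) unfolding lex_greater_def by blast
  have "min k l \<in> {1..m}" "\<forall>i\<in>{1..<min k l}. x i = z i"
    using k l by auto
  moreover have "x (min k l) > z (min k l)"
    using k l by (cases k l rule: linorder_cases) (auto simp: min_def)
  ultimately show ?thesis
    unfolding lex_greater_def by blast
qed

lemma lex_geq_trans:
  "lex_geq m x y \<Longrightarrow> lex_geq m y z \<Longrightarrow> lex_geq m x z"
  unfolding lex_geq_def by (auto intro: lex_greater_trans)

lemma not_lex_greater_self: "\<not> lex_greater m x x"
  unfolding lex_greater_def by auto

lemma lex_geq_antisym:
  "lex_geq m x y \<Longrightarrow> lex_geq m y x \<Longrightarrow> x = y"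
  unfolding lex_geq_def using lex_greater_trans not_lex_greater_self by blast

lemma lex_geq_linear:
  assumes "x \<in> Rn m" "y \<in> Rn m"
  shows "lex_geq m x y \<or> lex_geq m y x"
proof (cases "x = y")
  case True
  then show ?thesis by (simp add: lex_geq_def)
next
  case False
  define k where "k = (LEAST i. i \<in> {1..m} \<and> x i \<noteq> y i)"
  have "\<exists>i. i \<in> {1..m} \<and> x i \<noteq> y i"
    using assms False unfolding Rn_def by (metis PiE_ext)
  then have k: "k \<in> {1..m} \<and> x k \<noteq> y k"
    unfolding k_def by (rule LeastI_ex)
  have "\<forall>i\<in>{1..<k}. x i = y i"
  proof
    fix i assume i: "i \<in> {1..<k}"
    then have "\<not> (i \<in> {1..m} \<and> x i \<noteq> y i)"
      unfolding k_def using not_less_Least by auto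
    then show "x i = y i" using i k by auto
  qed
  then show ?thesis
    using k unfolding lex_geq_def lex_greater_def by (metis linorder_neqE)
qed

lemma lex_geq_truncate:
  assumes "lex_geq m x y" "m' \<le> m"
  shows "lex_geq m' (restrict x {1..m'}) (restrict y {1..m'})"
proof (cases "x = y")
  case True
  then show ?thesis by (simp add: lex_geq_def)
next
  case False
  then obtain k where k: "k \<in> {1..m}" "\<forall>i\<in>{1..<k}. x i = y i" "x k > y k"
    using assms(1) unfolding lex_geq_def lex_greater_def by blast
  show ?thesis
  proof (cases "k \<le> m'")
    case True
    then have "lex_greater m' (restrict x {1..m'}) (restrict y {1..m'})"
      using k unfolding lex_greater_def by (intro bexI[of _ k]) auto
    then show ?thesis by (simp add: lex_geq_def)
  next
    case False
    then have "restrict x {1..m'} = restrict y {1..m'}"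
      using k by (intro restrict_ext) auto
    then show ?thesis by (simp add: lex_geq_def)
  qed
qed

definition lex_maximizer :: "nat \<Rightarrow> ('a \<Rightarrow> vector) \<Rightarrow> 'a set \<Rightarrow> 'a \<Rightarrow> bool" where
  "lex_maximizer m s A z \<longleftrightarrow> z \<in> A \<and> (\<forall>y\<in>A. lex_geq m (s z) (s y))"

lemma lex_maximizer_exists:
  assumes "finite A" "A \<noteq> {}" "\<And>z. z \<in> A \<Longrightarrow> s z \<in> Rn m"
  shows "\<exists>z. lex_maximizer m s A z"
  using assms
proof (induction A rule: finite_ne_induct)
  case (singleton a)
  then show ?case by (auto simp: lex_maximizer_def lex_geq_def)
next
  case (insert a A)
  then obtain z where z: "z \<in> A" "\<forall>y\<in>A. lex_geq m (s z) (s y)"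
    unfolding lex_maximizer_def by auto
  have refl: "lex_geq m (s a) (s a)" by (simp add: lex_geq_def)
  from insert.prems z(1) have "lex_geq m (s z) (s a) \<or> lex_geq m (s a) (s z)"
    by (intro lex_geq_linear) auto
  then show ?case
  proof
    assume "lex_geq m (s z) (s a)"
    then have "lex_maximizer m s (insert a A) z"
      using z by (auto simp: lex_maximizer_def)
    then show ?thesis ..
  next
    assume "lex_geq m (s a) (s z)"
    then have "lex_maximizer m s (insert a A) a"
      using z refl by (auto simp: lex_maximizer_def intro: lex_geq_trans)
    then show ?thesis ..
  qed
qed

lemma lex_maximizer_value_unique:
  "lex_maximizer m s A z \<Longrightarrow> lex_maximizer m s A z' \<Longrightarrow> s z = s z'"
  unfolding lex_maximizer_def by (blast intro: lex_geq_antisym)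

text \<open>
  A prefix of a lexicographically largest vector is itself largest among the prefixes.  The
  surjectivity of \<open>\<psi>\<close> ensures that every competitor for the truncated key \<open>s'\<close> is the
  truncation of a competitor for \<open>s\<close>.
\<close>

lemma lex_maximizer_truncate:
  assumes max: "lex_maximizer m s A z"
    and le: "m' \<le> m"
    and surj: "\<psi> ` A = A"
    and trunc: "\<And>y. y \<in> A \<Longrightarrow> restrict (s y) {1..m'} = s' (\<psi> y)"
  shows "lex_maximizer m' s' A (\<psi> z)"
  unfolding lex_maximizer_def
proof (intro conjI ballI)
  have z: "z \<in> A" using max by (simp add: lex_maximizer_def)
  then show "\<psi> z \<in> A" using surj by blast
  fix y' assume "y' \<in> A"
  then obtain y where y: "y \<in> A" "y' = \<psi> y" using surj by blast
  have "lex_geq m (s z) (s y)" using max y by (simp add: lex_maximizer_def)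
  from lex_geq_truncate[OF this le] show "lex_geq m' (s' (\<psi> z)) (s' y')"
    using trunc z y by simp
qed

section \<open>Orbits of a group of bijections\<close>

lemma BijGroup_mult_apply:
  assumes "g \<in> Bij S" "h \<in> Bij S" "x \<in> S"
  shows "(g \<otimes>\<^bsub>BijGroup S\<^esub> h) x = g (h x)"
  using assms by (simp add: BijGroup_def compose_eq)

lemma subgroup_BijGroup_Bij:
  "subgroup \<Gamma> (BijGroup S) \<Longrightarrow> g \<in> \<Gamma> \<Longrightarrow> g \<in> Bij S"
  using subgroup.subset by (force simp: BijGroup_def)

lemma subgroup_BijGroup_in:
  "subgroup \<Gamma> (BijGroup S) \<Longrightarrow> g \<in> \<Gamma> \<Longrightarrow> x \<in> S \<Longrightarrow> g x \<in> S"
  using subgroup_BijGroup_Bij Bij_imp_funcset by fastforce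

lemma orbit_translate:
  assumes G: "subgroup \<Gamma> (BijGroup S)" and x: "x \<in> S" and d: "\<delta> \<in> \<Gamma>"
  shows "(\<lambda>\<gamma>. \<gamma> (\<delta> x)) ` \<Gamma> = (\<lambda>\<gamma>. \<gamma> x) ` \<Gamma>"
    and "\<delta> ` ((\<lambda>\<gamma>. \<gamma> x) ` \<Gamma>) = (\<lambda>\<gamma>. \<gamma> x) ` \<Gamma>"
proof -
  let ?B = "BijGroup S"
  interpret B: group ?B by (rule group_BijGroup)
  note bij = subgroup_BijGroup_Bij[OF G]
  have mult: "g \<otimes>\<^bsub>?B\<^esub> h \<in> \<Gamma>" "(g \<otimes>\<^bsub>?B\<^esub> h) x = g (h x)" if "g \<in> \<Gamma>" "h \<in> \<Gamma>" for g h
    using that subgroup.m_closed[OF G] BijGroup_mult_apply[OF bij bij x] by auto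
  have car: "g \<in> carrier ?B" if "g \<in> \<Gamma>" for g
    using that subgroup.subset[OF G] by blast
  have inv: "inv\<^bsub>?B\<^esub> \<delta> \<in> \<Gamma>" using subgroup.m_inv_closed[OF G d] .
  have right: "\<gamma> \<otimes>\<^bsub>?B\<^esub> inv\<^bsub>?B\<^esub> \<delta> \<otimes>\<^bsub>?B\<^esub> \<delta> = \<gamma>"
    and left: "\<delta> \<otimes>\<^bsub>?B\<^esub> (inv\<^bsub>?B\<^esub> \<delta> \<otimes>\<^bsub>?B\<^esub> \<gamma>) = \<gamma>" if "\<gamma> \<in> \<Gamma>" for \<gamma>
    using car[OF that] car[OF d] car[OF inv] by (simp_all add: B.m_assoc flip: B.m_assoc[of \<delta>])
  show "(\<lambda>\<gamma>. \<gamma> (\<delta> x)) ` \<Gamma> = (\<lambda>\<gamma>. \<gamma> x) ` \<Gamma>"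
  proof (intro equalityI subsetI)
    fix y assume "y \<in> (\<lambda>\<gamma>. \<gamma> (\<delta> x)) ` \<Gamma>"
    then obtain \<gamma> where "\<gamma> \<in> \<Gamma>" "y = \<gamma> (\<delta> x)" by blast
    then show "y \<in> (\<lambda>\<gamma>. \<gamma> x) ` \<Gamma>"
      using mult d by (intro image_eqI[of _ _ "\<gamma> \<otimes>\<^bsub>?B\<^esub> \<delta>"]) auto
  next
    fix y assume "y \<in> (\<lambda>\<gamma>. \<gamma> x) ` \<Gamma>"
    then obtain \<gamma> where g: "\<gamma> \<in> \<Gamma>" "y = \<gamma> x" by blast
    have "y = (\<gamma> \<otimes>\<^bsub>?B\<^esub> inv\<^bsub>?B\<^esub> \<delta>) (\<delta> x)"
      using mult(2)[OF mult(1)[OF g(1) inv] d] right[OF g(1)] g(2) by simp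
    then show "y \<in> (\<lambda>\<gamma>. \<gamma> (\<delta> x)) ` \<Gamma>" using mult(1)[OF g(1) inv] by blast
  qed
  show "\<delta> ` ((\<lambda>\<gamma>. \<gamma> x) ` \<Gamma>) = (\<lambda>\<gamma>. \<gamma> x) ` \<Gamma>"
  proof (intro equalityI subsetI)
    fix y assume "y \<in> \<delta> ` ((\<lambda>\<gamma>. \<gamma> x) ` \<Gamma>)"
    then obtain \<gamma> where "\<gamma> \<in> \<Gamma>" "y = \<delta> (\<gamma> x)" by blast
    then show "y \<in> (\<lambda>\<gamma>. \<gamma> x) ` \<Gamma>"
      using mult d by (intro image_eqI[of _ _ "\<delta> \<otimes>\<^bsub>?B\<^esub> \<gamma>"]) auto
  next
    fix y assume "y \<in> (\<lambda>\<gamma>. \<gamma> x) ` \<Gamma>"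
    then obtain \<gamma> where g: "\<gamma> \<in> \<Gamma>" "y = \<gamma> x" by blast
    have "y = \<delta> ((inv\<^bsub>?B\<^esub> \<delta> \<otimes>\<^bsub>?B\<^esub> \<gamma>) x)"
      using mult(2)[OF d mult(1)[OF inv g(1)]] left[OF g(1)] g(2) by simp
    then show "y \<in> \<delta> ` ((\<lambda>\<gamma>. \<gamma> x) ` \<Gamma>)" using mult(1)[OF inv g(1)] by blast
  qed
qed

section \<open>Marked paths in rooted trees\<close>

text \<open>
  The marked nodes form a path that starts at the root and can only stop at a leaf.
  A marked node of maximal distance from the root is such a leaf.  For uniqueness, any two
  marked nodes are comparable: following the path to one of them, the other can be left behind
  only at a node with two marked children.
\<close>

lemma ex1_marked_leaf:
  assumes tree: "finite_rooted_tree V E r"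
    and root: "P r"
    and up: "\<And>u v. (u, v) \<in> E \<Longrightarrow> P v \<Longrightarrow> P u"
    and down: "\<And>u. u \<in> V \<Longrightarrow> \<not> leaf V E u \<Longrightarrow> P u \<Longrightarrow> \<exists>!v. (u, v) \<in> E \<and> P v"
  shows "\<exists>!v. leaf V E v \<and> P v"
proof (rule ex_ex1I)
  have fin: "finite V" and EV: "E \<subseteq> V \<times> V" and rV: "r \<in> V" and nor: "\<And>u. (u, r) \<notin> E"
    and parent: "\<And>v. v \<in> V \<Longrightarrow> v \<noteq> r \<Longrightarrow> \<exists>!u. (u, v) \<in> E"
    and reach: "\<And>v. v \<in> V \<Longrightarrow> (r, v) \<in> E\<^sup>*"
    using tree unfolding finite_rooted_tree_def by auto
  define d where "d v = (LEAST k. (r, v) \<in> E ^^ k)" for v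
  \<comment> \<open>A shortest path to \<open>v\<close> ends with the unique edge into \<open>v\<close>.\<close>
  have deeper: "d u < d v" if uv: "(u, v) \<in> E" for u v
  proof -
    have v: "v \<in> V" "v \<noteq> r" using uv EV nor by auto
    have "\<exists>k. (r, v) \<in> E ^^ k" using reach[OF v(1)] by (rule rtrancl_imp_relpow)
    then have dv: "(r, v) \<in> E ^^ d v" unfolding d_def by (rule LeastI_ex)
    then obtain k where k: "d v = Suc k" using v(2) by (cases "d v") auto
    with dv obtain u' where "(r, u') \<in> E ^^ k" "(u', v) \<in> E" by auto
    then have "(r, u) \<in> E ^^ k" using parent[OF v] uv by blast
    then have "d u \<le> k" unfolding d_def by (rule Least_le)
    then show ?thesis using k by simp
  qed
  show "\<exists>v. leaf V E v \<and> P v"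
  proof -
    let ?M = "{v \<in> V. P v}"
    have "finite ?M" "?M \<noteq> {}" using fin rV root by auto
    then obtain v where v: "v \<in> ?M" and max: "\<And>w. w \<in> ?M \<Longrightarrow> d w \<le> d v"
      using Max_in[of "d ` ?M"] Max_ge[of "d ` ?M"] by fastforce
    have "leaf V E v"
    proof (rule ccontr)
      assume "\<not> leaf V E v"
      then obtain w where "(v, w) \<in> E" "P w" using v down by blast
      then show False using max[of w] deeper[of v w] EV by auto
    qed
    then show ?thesis using v by blast
  qed
  have comparable: "(v, w) \<in> E\<^sup>* \<or> (w, v) \<in> E\<^sup>*" if w: "w \<in> V" "P w" and "(r, v) \<in> E\<^sup>*" "P v" for v w
    using that(3,4)
  proof (induction rule: rtrancl_induct)
    case base
    then show ?case using reach w by blast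
  next
    case (step u v)
    have "P u" using up step.hyps(2) step.prems by blast
    with step.IH consider "(w, u) \<in> E\<^sup>*" | "(u, w) \<in> E\<^sup>*" "u \<noteq> w" by auto
    then show ?case
    proof cases
      case 1
      then show ?thesis using step.hyps(2) by (meson rtrancl.rtrancl_into_rtrancl)
    next
      case 2
      then obtain v' where v': "(u, v') \<in> E" "(v', w) \<in> E\<^sup>*" by (meson converse_rtranclE)
      have "P v'" using v'(2) w(2)
        by (induction rule: converse_rtrancl_induct) (auto intro: up)
      moreover have "u \<in> V" "\<not> leaf V E u" using step.hyps(2) EV by (auto simp: leaf_def)
      ultimately have "v = v'" using down \<open>P u\<close> v'(1) step.hyps(2) step.prems by blast
      then show ?thesis using v'(2) by blast
    qed
  qed
  fix v w
  assume v: "leaf V E v \<and> P v" and w: "leaf V E w \<and> P w"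
  then have "(v, w) \<in> E\<^sup>* \<or> (w, v) \<in> E\<^sup>*"
    using comparable[of w v] reach by (auto simp: leaf_def)
  then show "v = w"
    using v w unfolding leaf_def by (elim disjE) (blast elim: converse_rtranclE)+
qed

section \<open>Symmetry handling in the branch-and-bound tree\<close>

lemma sigma_in_Rn: "sigma n m p \<phi> x \<in> Rn m"
  unfolding sigma_def Rn_def by auto

text \<open>
  The constraints at a point quantify over the orbit of that point.  It coincides with the orbit
  of \<open>x\<close>, so satisfying them is a property relative to one fixed set of competitors.
\<close>

lemma satisfies_shc_iff_lex_maximizer:
  assumes "subgroup \<Gamma> (BijGroup S)" "x \<in> S" "\<xi> \<in> \<Gamma>"
  shows "satisfies_shc n \<Gamma> m p \<phi> (\<xi> x) \<longleftrightarrow>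
    lex_maximizer m (sigma n m p \<phi>) ((\<lambda>\<gamma>. \<gamma> x) ` \<Gamma>) (\<xi> x)"
proof -
  have "satisfies_shc n \<Gamma> m p \<phi> (\<xi> x) \<longleftrightarrow>
      (\<forall>y\<in>(\<lambda>\<gamma>. \<gamma> (\<xi> x)) ` \<Gamma>. lex_geq m (sigma n m p \<phi> (\<xi> x)) (sigma n m p \<phi> y))"
    by (simp add: satisfies_shc_def)
  then show ?thesis
    using assms(3) by (simp add: orbit_translate(1)[OF assms] lex_maximizer_def)
qed

theorem theorem8:
  fixes n :: nat
    and \<Phi> :: "vector set"
    and f :: "vector \<Rightarrow> real"
    and \<Gamma> :: "(vector \<Rightarrow> vector) set"
    and V :: "'v set"
    and E :: "('v \<times> 'v) set"
    and r :: 'v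
    and D :: "'v \<Rightarrow> 'v \<Rightarrow> vector set"
    and m :: "'v \<Rightarrow> nat"
    and \<pi> :: "'v \<Rightarrow> nat \<Rightarrow> nat"
    and \<phi> :: "'v \<Rightarrow> vector \<Rightarrow> vector"
  assumes feasible: "\<Phi> \<subseteq> Rn n"
    and symmetries: "finite_symmetry_group n \<Phi> f \<Gamma>"
    and tree: "full_bnb_tree V E r D \<Phi>"
    and m: "\<forall>\<beta>\<in>V. m \<beta> \<le> n"
    and \<pi>: "\<forall>\<beta>\<in>V. \<pi> \<beta> permutes {1..n}"
    and \<phi>: "\<forall>\<beta>\<in>V. \<phi> \<beta> \<in> \<Gamma>"
    and C1: "\<forall>\<beta>\<in>V. \<forall>\<alpha>\<in>V. (\<alpha>, \<beta>) \<in> E \<longrightarrow>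
      m \<beta> \<ge> m \<alpha> \<and>
      (\<forall>x\<in>Rn n. \<forall>i\<in>{1..m \<alpha>}. perm_action n (\<pi> \<alpha>) x i = perm_action n (\<pi> \<beta>) x i)"
    and C2: "\<forall>\<beta>\<in>V. \<forall>\<alpha>\<in>V. (\<alpha>, \<beta>) \<in> E \<longrightarrow>
      (\<exists>\<psi>\<in>{\<gamma> \<in> \<Gamma>. region E D \<Phi> \<alpha> = \<gamma> ` region E D \<Phi> \<alpha>}.
         \<phi> \<beta> = \<phi> \<alpha> \<otimes>\<^bsub>BijGroup (Rn n)\<^esub> \<psi>)"
    and C3: "\<forall>\<beta>\<in>V. \<forall>\<beta>'\<in>V. siblings E \<beta> \<beta>' \<longrightarrow>
      m \<beta> = m \<beta>' \<and> \<pi> \<beta> = \<pi> \<beta>' \<and> \<phi> \<beta> = \<phi> \<beta>'"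
    and C4: "\<forall>\<beta>\<in>V. \<forall>x\<in>region E D \<Phi> \<beta>. \<forall>\<xi>\<in>\<Gamma>.
      sigma n (m \<beta>) (\<pi> \<beta>) (\<phi> \<beta>) x = sigma n (m \<beta>) (\<pi> \<beta>) (\<phi> \<beta>) (\<xi> x) \<longrightarrow>
      \<xi> x \<in> region E D \<Phi> \<beta>"
  shows "\<forall>x\<in>\<Phi>. \<exists>!\<nu>. leaf V E \<nu> \<and>
    (\<exists>\<xi>\<in>\<Gamma>. \<xi> x \<in> region E D \<Phi> \<nu> \<and> satisfies_shc n \<Gamma> (m \<nu>) (\<pi> \<nu>) (\<phi> \<nu>) (\<xi> x))"
proof
  fix x assume x\<Phi>: "x \<in> \<Phi>"
  define Orb where "Orb = (\<lambda>\<gamma>. \<gamma> x) ` \<Gamma>"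
  define s where "s \<beta> = sigma n (m \<beta>) (\<pi> \<beta>) (\<phi> \<beta>)" for \<beta>
  define R where "R = region E D \<Phi>"
  define occupied where "occupied \<beta> \<longleftrightarrow> (\<exists>z\<in>R \<beta>. lex_maximizer (m \<beta>) (s \<beta>) Orb z)" for \<beta>

  have fin: "finite \<Gamma>" and grp: "subgroup \<Gamma> (BijGroup (Rn n))"
    and feas: "\<And>\<gamma> y. \<gamma> \<in> \<Gamma> \<Longrightarrow> y \<in> \<Phi> \<Longrightarrow> \<gamma> y \<in> \<Phi>"
    using symmetries feasible unfolding finite_symmetry_group_def is_symmetry_def by auto
  have rooted: "finite_rooted_tree V E r"
    and cover: "\<And>\<beta>. \<beta> \<in> V \<Longrightarrow> \<not> leaf V E \<beta> \<Longrightarrow> R \<beta> = (\<Union>\<omega>\<in>{\<omega>. (\<beta>, \<omega>) \<in> E}. R \<omega>)"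
    and disjoint: "\<And>\<beta>. \<beta> \<in> V \<Longrightarrow> \<not> leaf V E \<beta> \<Longrightarrow> disjoint_family_on R {\<omega>. (\<beta>, \<omega>) \<in> E}"
    using tree unfolding full_bnb_tree_def R_def by blast+
  have EV: "E \<subseteq> V \<times> V" and no_edge_to_root: "\<And>u. (u, r) \<notin> E"
    using rooted unfolding finite_rooted_tree_def by auto
  have x: "x \<in> Rn n" using x\<Phi> feasible by blast
  have Orb_Rn: "Orb \<subseteq> Rn n"
    unfolding Orb_def using subgroup_BijGroup_in[OF grp _ x] by blast
  have Orb_\<Phi>: "Orb \<subseteq> \<Phi>" unfolding Orb_def using feas x\<Phi> by blast
  have R_Rn: "R \<beta> \<subseteq> Rn n" for \<beta> using feasible unfolding R_def region_def by blast
  have "\<Gamma> \<noteq> {}" using subgroup.one_closed[OF grp] by blast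
  then have maximizer_exists: "\<exists>z. lex_maximizer (m \<beta>) (s \<beta>) Orb z" for \<beta>
    using fin by (intro lex_maximizer_exists) (auto simp: Orb_def s_def sigma_in_Rn)

  have same_value_in_region: "z' \<in> R \<beta>"
    if a: "\<beta> \<in> V" "z \<in> R \<beta>" "z \<in> Orb" "z' \<in> Orb" "s \<beta> z = s \<beta> z'" for \<beta> z z'
  proof -
    obtain \<delta> where \<delta>: "\<delta> \<in> \<Gamma>" "z = \<delta> x" using a(3) by (auto simp: Orb_def)
    have "z' \<in> (\<lambda>\<gamma>. \<gamma> z) ` \<Gamma>"
      using a(4) orbit_translate(1)[OF grp x \<delta>(1)] \<delta>(2) by (simp add: Orb_def)
    then obtain \<xi> where "\<xi> \<in> \<Gamma>" "z' = \<xi> z" by blast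
    then show ?thesis using C4 a(1,2,5) unfolding R_def s_def by blast
  qed
  have maximizer_in_region: "z \<in> R \<beta>"
    if "\<beta> \<in> V" "occupied \<beta>" "lex_maximizer (m \<beta>) (s \<beta>) Orb z" for \<beta> z
    using that same_value_in_region lex_maximizer_value_unique[OF _ that(3)]
    unfolding occupied_def by (metis lex_maximizer_def)

  \<comment> \<open>A maximizer \<open>z\<close> for a child corresponds to the maximizer \<open>\<psi> z\<close> for its parent, and
    the two lie in the parent's region together.\<close>
  have edge: "\<exists>y. lex_maximizer (m \<alpha>) (s \<alpha>) Orb y \<and> (y \<in> R \<alpha> \<longleftrightarrow> z \<in> R \<alpha>)"
    if ab: "(\<alpha>, \<beta>) \<in> E" and z: "lex_maximizer (m \<beta>) (s \<beta>) Orb z" for \<alpha> \<beta> z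
  proof -
    have V: "\<alpha> \<in> V" "\<beta> \<in> V" using ab EV by auto
    obtain \<psi> where \<psi>: "\<psi> \<in> \<Gamma>" "R \<alpha> = \<psi> ` R \<alpha>"
      and \<phi>\<psi>: "\<phi> \<beta> = \<phi> \<alpha> \<otimes>\<^bsub>BijGroup (Rn n)\<^esub> \<psi>"
      using C2 V ab unfolding R_def by blast
    have \<psi>_Orb: "\<psi> ` Orb = Orb"
      unfolding Orb_def by (rule orbit_translate(2)[OF grp x \<psi>(1)])
    have le: "m \<alpha> \<le> m \<beta>" using C1 V ab by blast
    have "restrict (s \<beta> y) {1..m \<alpha>} = s \<alpha> (\<psi> y)" if "y \<in> Orb" for y
    proof
      fix i
      have y: "y \<in> Rn n" using that Orb_Rn by blast
      have "\<phi> \<alpha> \<in> \<Gamma>" "\<phi> \<beta> \<in> \<Gamma>" using \<phi> V by auto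
      then have "\<phi> \<beta> y = \<phi> \<alpha> (\<psi> y)"
        using BijGroup_mult_apply subgroup_BijGroup_Bij[OF grp] \<psi>(1) y \<phi>\<psi> by metis
      moreover have "\<phi> \<beta> y \<in> Rn n"
        using subgroup_BijGroup_in[OF grp \<open>\<phi> \<beta> \<in> \<Gamma>\<close> y] .
      ultimately show "restrict (s \<beta> y) {1..m \<alpha>} i = s \<alpha> (\<psi> y) i"
        using C1 V ab le by (simp add: s_def sigma_def)
    qed
    then have "lex_maximizer (m \<alpha>) (s \<alpha>) Orb (\<psi> z)"
      by (rule lex_maximizer_truncate[OF z le \<psi>_Orb])
    moreover have "\<psi> z \<in> R \<alpha> \<longleftrightarrow> z \<in> R \<alpha>"
    proof -
      have "inj_on \<psi> (Rn n)"
        using subgroup_BijGroup_Bij[OF grp \<psi>(1)] by (simp add: Bij_def bij_betw_def)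
      moreover have "z \<in> Rn n" using z Orb_Rn by (auto simp: lex_maximizer_def)
      ultimately have "\<psi> z \<in> \<psi> ` R \<alpha> \<longleftrightarrow> z \<in> R \<alpha>"
        using R_Rn by (intro inj_on_image_mem_iff)
      then show ?thesis using \<psi>(2) by simp
    qed
    ultimately show ?thesis by blast
  qed

  have "occupied r"
  proof -
    have "{(u, v) \<in> E. (v, r) \<in> E\<^sup>*} = {}"
      using no_edge_to_root by (auto elim: rtranclE)
    then have "R r = \<Phi>" unfolding R_def region_def by blast
    then show ?thesis
      using maximizer_exists[of r] Orb_\<Phi> unfolding occupied_def lex_maximizer_def by blast
  qed
  moreover have "occupied \<alpha>" if child: "(\<alpha>, \<beta>) \<in> E" and occ: "occupied \<beta>" for \<alpha> \<beta>
  proof -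
    obtain z where z: "z \<in> R \<beta>" "lex_maximizer (m \<beta>) (s \<beta>) Orb z"
      using occ unfolding occupied_def by blast
    have "\<alpha> \<in> V" "\<not> leaf V E \<alpha>" using child EV by (auto simp: leaf_def)
    then have "z \<in> R \<alpha>" using cover[of \<alpha>] z(1) child by blast
    then show ?thesis using edge[OF child z(2)] unfolding occupied_def by blast
  qed
  moreover have "\<exists>!\<beta>. (\<alpha>, \<beta>) \<in> E \<and> occupied \<beta>"
    if \<alpha>: "\<alpha> \<in> V" "\<not> leaf V E \<alpha>" "occupied \<alpha>" for \<alpha>
  proof -
    have same: "m \<beta> = m \<beta>' \<and> s \<beta> = s \<beta>'" if "(\<alpha>, \<beta>) \<in> E" "(\<alpha>, \<beta>') \<in> E" for \<beta> \<beta>'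
    proof (cases "\<beta> = \<beta>'")
      case False
      then have "siblings E \<beta> \<beta>'" using that by (auto simp: siblings_def)
      moreover have "\<beta> \<in> V" "\<beta>' \<in> V" using that EV by auto
      ultimately show ?thesis using C3 by (simp add: s_def)
    qed simp
    show ?thesis
    proof (rule ex_ex1I)
      obtain \<beta> where \<beta>: "(\<alpha>, \<beta>) \<in> E" using \<alpha> by (auto simp: leaf_def)
      obtain z where z: "lex_maximizer (m \<beta>) (s \<beta>) Orb z" using maximizer_exists by blast
      obtain y where "lex_maximizer (m \<alpha>) (s \<alpha>) Orb y" "y \<in> R \<alpha> \<longleftrightarrow> z \<in> R \<alpha>"
        using edge[OF \<beta> z] by blast
      then have "z \<in> R \<alpha>" using maximizer_in_region \<alpha> by blast
      then obtain \<omega> where \<omega>: "(\<alpha>, \<omega>) \<in> E" "z \<in> R \<omega>" using cover[OF \<alpha>(1,2)] by blast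
      \<comment> \<open>The child \<open>\<omega>\<close> containing \<open>z\<close> may differ from \<open>\<beta>\<close>, but maximality means the same at both.\<close>
      then have "lex_maximizer (m \<omega>) (s \<omega>) Orb z" using same[OF \<beta> \<omega>(1)] z by simp
      then show "\<exists>\<beta>. (\<alpha>, \<beta>) \<in> E \<and> occupied \<beta>" using \<omega> unfolding occupied_def by blast
    next
      fix \<beta> \<beta>'
      assume \<beta>: "(\<alpha>, \<beta>) \<in> E \<and> occupied \<beta>" and \<beta>': "(\<alpha>, \<beta>') \<in> E \<and> occupied \<beta>'"
      obtain z where z: "z \<in> R \<beta>'" "lex_maximizer (m \<beta>') (s \<beta>') Orb z"
        using \<beta>' unfolding occupied_def by blast
      have "\<beta> \<in> V" using \<beta> EV by auto
      then have "z \<in> R \<beta>" using maximizer_in_region[of \<beta> z] \<beta> \<beta>' z(2) same[of \<beta> \<beta>'] by auto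
      with z(1) have "R \<beta> \<inter> R \<beta>' \<noteq> {}" by blast
      then show "\<beta> = \<beta>'"
        using disjoint[OF \<alpha>(1,2)] \<beta> \<beta>' unfolding disjoint_family_on_def by blast
    qed
  qed
  ultimately have "\<exists>!\<nu>. leaf V E \<nu> \<and> occupied \<nu>"
    by (rule ex1_marked_leaf[OF rooted])
  moreover have "occupied \<nu> \<longleftrightarrow> (\<exists>\<xi>\<in>\<Gamma>. \<xi> x \<in> region E D \<Phi> \<nu> \<and>
      satisfies_shc n \<Gamma> (m \<nu>) (\<pi> \<nu>) (\<phi> \<nu>) (\<xi> x))" for \<nu>
    using satisfies_shc_iff_lex_maximizer[OF grp x, of _ n "m \<nu>" "\<pi> \<nu>" "\<phi> \<nu>"]
    unfolding occupied_def R_def s_def Orb_def by (auto simp: lex_maximizer_def)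
  ultimately show "\<exists>!\<nu>. leaf V E \<nu> \<and> (\<exists>\<xi>\<in>\<Gamma>. \<xi> x \<in> region E D \<Phi> \<nu> \<and>
      satisfies_shc n \<Gamma> (m \<nu>) (\<pi> \<nu>) (\<phi> \<nu>) (\<xi> x))"
    by simp
qed

end
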